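(* Let $K$ be a field, $X=\{x_1,\dots,x_n\}$, and let $I\subsetneq P=K[X]$ be a radical ideal. Consider the following procedure. (1) Compute the prime decomposition $I=\mathfrak p_1\cap\cdots\cap\mathfrak p_k$. (2) For each $\mathfrak p_i$ compute the maximal set $Y_i\subseteq X$ such that $\mathfrak p_i:\langle\prod_{x_j\in Y_i}x_j\rangle=\mathfrak p_i$. (3) For $i=1,\dots,k$ compute $J_i=\operatorname{Bin}(\mathfrak p_i\cap K[Y_i])$, and obtain $\operatorname{Bin}(\mathfrak p_i)=J_i+\langle X\setminus Y_i\rangle$. (4) Return the ideal $$\sum_{S\subseteq\{1,\dots,k\}}\Bigl(\bigcap_{j\notin S}\langle X\setminus Y_j\rangle\Bigr)\cap J_S,$$ where $J_S=\operatorname{Bin}\bigl(\bigcap_{i\in S}J_i\bigr)$ for $S\ne\emptyset$ and $J_\emptyset=\langle1\rangle$. Then the returned ideal is the binomial part $\operatorname{Bin}(I)$.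
   Context: A term is a product $x_1^{\alpha_1}\cdots x_n^{\alpha_n}$ with $\alpha_i\ge0$; a monomial is $at$ with $a\in K\setminus\{0\}$, $t$ a term; a binomial is $as+bt$ with $a,b\in K\setminus\{0\}$, $s,t$ terms. For an ideal $I$ of a polynomial ring over $K$, $\operatorname{Bin}(I)$ is the ideal generated by all monomials and binomials contained in $I$. In $J_i+\langle X\setminus Y_i\rangle$ and in $\bigcap_{i\in S}J_i$, the ideals $J_i\subseteq K[Y_i]$ are identified with their extensions $J_iK[X]$. An empty intersection of ideals of $P$ is $P$. *)

theory Defs
  imports "HOL-Algebra.Ideal" "HOL-Library.Poly_Mapping"
begin

section \<open>Ideal operations in a ring\<close>

definition radical_ideal :: "'a set \<Rightarrow> ('a, 'b) ring_scheme \<Rightarrow> bool" where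
  "radical_ideal I R \<longleftrightarrow>
     ideal I R \<and> (\<forall>a\<in>carrier R. \<forall>n::nat. a [^]\<^bsub>R\<^esub> n \<in> I \<longrightarrow> a \<in> I)"

definition ideal_colon :: "('a, 'b) ring_scheme \<Rightarrow> 'a set \<Rightarrow> 'a set \<Rightarrow> 'a set" where
  "ideal_colon R I J = {a \<in> carrier R. \<forall>b\<in>J. a \<otimes>\<^bsub>R\<^esub> b \<in> I}"

text \<open>The intersection is taken inside the carrier, so that an empty family gives the unit ideal.\<close>

definition ideal_Inter :: "('a, 'b) ring_scheme \<Rightarrow> 'i set \<Rightarrow> ('i \<Rightarrow> 'a set) \<Rightarrow> 'a set" where
  "ideal_Inter R A T = carrier R \<inter> (\<Inter>i\<in>A. T i)"

definition ideal_Sum :: "('a, 'b) ring_scheme \<Rightarrow> 'i set \<Rightarrow> ('i \<Rightarrow> 'a set) \<Rightarrow> 'a set" where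
  "ideal_Sum R A T = {finsum R f A | f. \<forall>i\<in>A. f i \<in> T i}"

text \<open>A prime decomposition is taken to be irredundant; the \<open>p i\<close> are then pairwise distinct
  and are the minimal primes of \<open>I\<close>.\<close>

definition prime_decomposition ::
    "('a, 'b) ring_scheme \<Rightarrow> 'a set \<Rightarrow> nat \<Rightarrow> (nat \<Rightarrow> 'a set) \<Rightarrow> bool" where
  "prime_decomposition R I k p \<longleftrightarrow>
     (\<forall>i\<in>{1..k}. primeideal (p i) R) \<and>
     I = ideal_Inter R {1..k} p \<and>
     (\<forall>i\<in>{1..k}. ideal_Inter R ({1..k} - {i}) p \<noteq> I)"

section \<open>Polynomial rings and binomial parts\<close>

text \<open>A power product is its exponent vector, a polynomial a finitely supported map from
  power products to coefficients; multiplication on the type is the convolution product.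
  All the rings \<open>K[Y]\<close> live in the same type, hence \<open>K[Y] \<subseteq> K[X]\<close>
  literally when \<open>Y \<subseteq> X\<close>.\<close>

type_synonym ('x, 'k) mpoly = "('x \<Rightarrow>\<^sub>0 nat) \<Rightarrow>\<^sub>0 'k"

definition poly_ring :: "'x set \<Rightarrow> ('x, 'k::field) mpoly ring" where
  "poly_ring Y =
     \<lparr>carrier = {f. \<forall>t\<in>Poly_Mapping.keys f. Poly_Mapping.keys t \<subseteq> Y},
      mult = (*), one = 1, zero = 0, add = (+)\<rparr>"

definition Var :: "'x \<Rightarrow> ('x, 'k::field) mpoly" where
  "Var x = Poly_Mapping.single (Poly_Mapping.single x 1) 1"

definition is_monomial :: "('x, 'k::field) mpoly \<Rightarrow> bool" where
  "is_monomial f \<longleftrightarrow> (\<exists>a t. a \<noteq> 0 \<and> f = Poly_Mapping.single t a)"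

text \<open>The two terms of a binomial may coincide.\<close>

definition is_binomial :: "('x, 'k::field) mpoly \<Rightarrow> bool" where
  "is_binomial f \<longleftrightarrow>
     (\<exists>a b s t. a \<noteq> 0 \<and> b \<noteq> 0 \<and> f = Poly_Mapping.single s a + Poly_Mapping.single t b)"

definition Bin :: "'x set \<Rightarrow> ('x, 'k::field) mpoly set \<Rightarrow> ('x, 'k) mpoly set" where
  "Bin Y I = genideal (poly_ring Y) {f \<in> I. is_monomial f \<or> is_binomial f}"

definition var_ideal :: "'x set \<Rightarrow> 'x set \<Rightarrow> ('x, 'k::field) mpoly set" where
  "var_ideal X Z = genideal (poly_ring X) (Var ` Z)"

definition ideal_ext :: "'x set \<Rightarrow> ('x, 'k::field) mpoly set \<Rightarrow> ('x, 'k) mpoly set" where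
  "ideal_ext X J = genideal (poly_ring X) J"

definition prod_colon_eq :: "'x set \<Rightarrow> ('x, 'k::field) mpoly set \<Rightarrow> 'x set \<Rightarrow> bool" where
  "prod_colon_eq X \<pp> Y \<longleftrightarrow>
     ideal_colon (poly_ring X) \<pp> (genideal (poly_ring X) {\<Prod>x\<in>Y. Var x}) = \<pp>"

definition maximal_var_set :: "'x set \<Rightarrow> ('x, 'k::field) mpoly set \<Rightarrow> 'x set \<Rightarrow> bool" where
  "maximal_var_set X \<pp> Y \<longleftrightarrow>
     Y \<subseteq> X \<and> prod_colon_eq X \<pp> Y \<and>
     (\<forall>Z. Y \<subseteq> Z \<and> Z \<subseteq> X \<and> prod_colon_eq X \<pp> Z \<longrightarrow> Z = Y)"

definition J_sub ::
    "'x set \<Rightarrow> (nat \<Rightarrow> ('x, 'k::field) mpoly set) \<Rightarrow> nat set \<Rightarrow> ('x, 'k) mpoly set" where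
  "J_sub X J S =
     (if S = {} then genideal (poly_ring X) {1}
      else Bin X (ideal_Inter (poly_ring X) S (\<lambda>i. ideal_ext X (J i))))"

definition returned_ideal ::
    "'x set \<Rightarrow> nat \<Rightarrow> (nat \<Rightarrow> 'x set) \<Rightarrow> (nat \<Rightarrow> ('x, 'k::field) mpoly set) \<Rightarrow> ('x, 'k) mpoly set" where
  "returned_ideal X k Y J =
     ideal_Sum (poly_ring X) (Pow {1..k})
       (\<lambda>S. ideal_Inter (poly_ring X) ({1..k} - S) (\<lambda>j. var_ideal X (X - Y j)) \<inter> J_sub X J S)"

lemma poly_ring_cring: "cring (poly_ring Y :: ('x, 'k::field) mpoly ring)"
proof -
  let ?R = "poly_ring Y :: ('x, 'k) mpoly ring"
  let ?P = "\<lambda>f :: ('x, 'k) mpoly. \<forall>t\<in>Poly_Mapping.keys f. Poly_Mapping.keys t \<subseteq> Y"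
  have mult: "?P (f * g)" if f: "?P f" and g: "?P g" for f g
  proof
    fix t assume "t \<in> Poly_Mapping.keys (f * g)"
    then obtain u v where uv: "u \<in> Poly_Mapping.keys f" "v \<in> Poly_Mapping.keys g" "t = u + v"
      using Poly_Mapping.keys_mult[of f g] by blast
    have "Poly_Mapping.keys t \<subseteq> Poly_Mapping.keys u \<union> Poly_Mapping.keys v"
      unfolding uv(3) by (rule Poly_Mapping.keys_add)
    then show "Poly_Mapping.keys t \<subseteq> Y"
      using f g uv(1,2) by blast
  qed
  have add: "?P (f + g)" if "?P f" "?P g" for f g
    using that Poly_Mapping.keys_add[of f g] by blast
  have neg: "?P (- f)" if "?P f" for f
    using that by simp
  have carrier: "f \<in> carrier ?R \<longleftrightarrow> ?P f" for f
    by (simp add: poly_ring_def)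
  have ops: "mult ?R = (*)" "one ?R = 1" "zero ?R = 0" "add ?R = (+)"
    by (simp_all add: poly_ring_def)
  have closed: "f * g \<in> carrier ?R" "f + g \<in> carrier ?R" "- f \<in> carrier ?R"
    if "f \<in> carrier ?R" "g \<in> carrier ?R" for f g
    using that mult[of f g] add[of f g] neg[of f] unfolding carrier by blast+
  have units: "0 \<in> carrier ?R" "1 \<in> carrier ?R"
    by (simp_all add: poly_ring_def)
  show ?thesis
  proof (rule cringI)
    show "abelian_group ?R"
    proof (rule abelian_groupI)
      fix f assume "f \<in> carrier ?R"
      then have "- f \<in> carrier ?R" "- f \<oplus>\<^bsub>?R\<^esub> f = \<zero>\<^bsub>?R\<^esub>"
        by (simp_all add: ops closed(3)[of f f])
      then show "\<exists>g\<in>carrier ?R. g \<oplus>\<^bsub>?R\<^esub> f = \<zero>\<^bsub>?R\<^esub>"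
        by blast
    qed (simp_all add: ops closed units ac_simps)
    show "comm_monoid ?R"
      by (rule comm_monoidI) (simp_all add: ops closed units ac_simps)
  qed (simp add: ops distrib_right)
qed

end

theory Submission
  imports Defs
begin

text \<open>
  The terms in a prime ideal \<open>p\<close> are the multiples of the variables in \<open>p\<close>, and these variables
  are exactly \<open>X - Y\<close> (\<open>maximal_var_set_prime\<close>). A binomial of \<open>p\<close> with one term in \<open>p\<close> has both
  terms in \<open>p\<close>; hence every monomial or binomial of \<open>p\<close> lies in \<open>\<langle>X - Y\<rangle>\<close> or in \<open>K[Y]\<close>
  (\<open>prime_monomial_or_binomial_cases\<close>). This gives the formula for \<open>Bin p\<close>. It also shows that a
  monomial or binomial \<open>g\<close> of \<open>I\<close> lies in the summand of the set \<open>S\<close> of all \<open>i\<close> for which \<open>g\<close> is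
  not in \<open>\<langle>X - Y i\<rangle>\<close>, so that the returned ideal contains \<open>Bin I\<close>.

  For the converse, each summand with \<open>S \<noteq> \<emptyset>\<close> is the intersection of a monomial ideal \<open>M\<close> with the
  binomial part of an ideal \<open>N\<close>. Here it is decisive that an element \<open>f\<close> of the binomial part is a
  sum of monomials and binomials of \<open>N\<close> all of whose terms occur in \<open>f\<close> (\<open>bin_span_in_support\<close>):
  if \<open>f\<close> is in \<open>M\<close> then so are all these pieces, because membership in \<open>M\<close> depends on the terms
  only. Each piece is therefore in every \<open>p i\<close>, either through \<open>M\<close> or through \<open>N\<close>, and so in \<open>I\<close>.
  For \<open>S = \<emptyset>\<close> the summand is a monomial ideal contained in \<open>I\<close>.
\<close>

section \<open>Ideals of a polynomial ring\<close>

lemma poly_ring_simps [simp]: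
  "mult (poly_ring Y) = (*)" "one (poly_ring Y) = 1"
  "zero (poly_ring Y) = 0" "add (poly_ring Y) = (+)"
  by (simp_all add: poly_ring_def)

lemma carrier_poly_ring:
  "f \<in> carrier (poly_ring Y) \<longleftrightarrow> (\<forall>t\<in>Poly_Mapping.keys f. Poly_Mapping.keys t \<subseteq> Y)"
  by (simp add: poly_ring_def)

lemma ring_poly_ring: "ring (poly_ring Y)"
  using poly_ring_cring cring.axioms(1) by blast

lemma single_in_carrier:
  "Poly_Mapping.keys t \<subseteq> Y \<Longrightarrow> Poly_Mapping.single t a \<in> carrier (poly_ring Y)"
  by (simp add: carrier_poly_ring)

lemma Var_in_carrier: "x \<in> Y \<Longrightarrow> Var x \<in> carrier (poly_ring Y)"
  unfolding Var_def by (rule single_in_carrier) simp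

lemma poly_ideal_iff:
  fixes A :: "('x, 'k::field) mpoly set"
  shows
  "ideal A (poly_ring Y) \<longleftrightarrow>
     A \<subseteq> carrier (poly_ring Y) \<and> 0 \<in> A \<and> (\<forall>f\<in>A. \<forall>g\<in>A. f + g \<in> A) \<and>
     (\<forall>f\<in>carrier (poly_ring Y). \<forall>g\<in>A. f * g \<in> A)" (is "?L \<longleftrightarrow> ?R")
proof
  assume L: ?L
  interpret ideal A "poly_ring Y" by (rule L)
  show ?R
    using a_subset additive_subgroup.zero_closed[OF is_additive_subgroup]
      additive_subgroup.a_closed[OF is_additive_subgroup] I_l_closed by simp
next
  assume R: ?R
  interpret cring "poly_ring Y :: ('x, 'k) mpoly ring" by (rule poly_ring_cring)
  have minus_one: "- 1 \<in> carrier (poly_ring Y :: ('x, 'k) mpoly ring)"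
    by (simp add: carrier_poly_ring)
  have uminus: "- f \<in> A" if "f \<in> A" for f
    using R that minus_one mult_minus1 by metis
  have "a_inv (poly_ring Y) f = - f" if "f \<in> A" for f
  proof (rule minus_equality)
    show "f \<in> carrier (poly_ring Y)" "- f \<in> carrier (poly_ring Y)"
      using R that uminus by blast+
  qed simp
  then have "subgroup A (add_monoid (poly_ring Y))"
    using R uminus by (intro add.subgroupI) (auto simp: a_inv_def)
  then show ?L
  proof (rule idealI[OF ring_poly_ring])
    fix f h :: "('x, 'k) mpoly" assume "f \<in> A" "h \<in> carrier (poly_ring Y)"
    then show "h \<otimes>\<^bsub>poly_ring Y\<^esub> f \<in> A" "f \<otimes>\<^bsub>poly_ring Y\<^esub> h \<in> A"
      using R by (simp_all add: mult.commute[of f h])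
  qed
qed

lemma poly_ideal_sum:
  assumes "ideal A (poly_ring Y)" "\<And>i. i \<in> B \<Longrightarrow> h i \<in> A"
  shows "sum h B \<in> A"
  using assms(2)
  by (induction B rule: infinite_finite_induct) (use assms(1) in \<open>auto simp: poly_ideal_iff\<close>)

lemma poly_ideal_diff:
  assumes A: "ideal A (poly_ring Y)" and "f \<in> A" "g \<in> A"
  shows "f - g \<in> A"
proof -
  have "- 1 \<in> carrier (poly_ring Y :: ('a, 'b) mpoly ring)"
    by (simp add: carrier_poly_ring)
  then have "- 1 * g \<in> A"
    using assms unfolding poly_ideal_iff by blast
  then have "f + - 1 * g \<in> A"
    using assms unfolding poly_ideal_iff by blast
  then show ?thesis by simp
qed

lemma mem_ideal_Inter:
  "f \<in> ideal_Inter R B T \<longleftrightarrow> f \<in> carrier R \<and> (\<forall>i\<in>B. f \<in> T i)"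
  by (auto simp: ideal_Inter_def)

lemma poly_ideal_Inter:
  fixes T :: "'i \<Rightarrow> ('x, 'k::field) mpoly set"
  assumes "\<And>i. i \<in> B \<Longrightarrow> ideal (T i) (poly_ring Y)"
  shows "ideal (ideal_Inter (poly_ring Y) B T) (poly_ring Y)"
proof -
  have "ideal (carrier (poly_ring Y)) (poly_ring Y :: ('x, 'k) mpoly ring)"
    by (rule ring.oneideal[OF ring_poly_ring])
  then show ?thesis
    using assms unfolding ideal_Inter_def poly_ideal_iff
    by (intro conjI ballI) (simp_all add: subset_iff)
qed

lemma finsum_poly_ring:
  fixes h :: "'i \<Rightarrow> ('x, 'k::field) mpoly"
  assumes "finite B" "\<And>i. i \<in> B \<Longrightarrow> h i \<in> carrier (poly_ring Y)"
  shows "finsum (poly_ring Y) h B = sum h B"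
proof -
  interpret cring "poly_ring Y :: ('x, 'k) mpoly ring" by (rule poly_ring_cring)
  show ?thesis
    using assms by (induction B) auto
qed

lemma poly_mapping_eq_sum_single:
  fixes f :: "'a \<Rightarrow>\<^sub>0 'b::comm_monoid_add"
  shows "f = (\<Sum>t\<in>Poly_Mapping.keys f. Poly_Mapping.single t (Poly_Mapping.lookup f t))"
proof (rule poly_mapping_eqI)
  fix u
  have "Poly_Mapping.lookup (\<Sum>t\<in>Poly_Mapping.keys f. Poly_Mapping.single t (Poly_Mapping.lookup f t)) u
      = (\<Sum>t\<in>Poly_Mapping.keys f. if t = u then Poly_Mapping.lookup f t else 0)"
    by (simp add: lookup_sum lookup_single when_def)
  also have "\<dots> = Poly_Mapping.lookup f u"
    by (simp add: in_keys_iff)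
  finally show "Poly_Mapping.lookup f u = Poly_Mapping.lookup
      (\<Sum>t\<in>Poly_Mapping.keys f. Poly_Mapping.single t (Poly_Mapping.lookup f t)) u" ..
qed

lemma keys_add_nat:
  fixes s t :: "'x \<Rightarrow>\<^sub>0 nat"
  shows "Poly_Mapping.keys (s + t) = Poly_Mapping.keys s \<union> Poly_Mapping.keys t"
  by (auto simp: in_keys_iff lookup_add)

section \<open>The binomial part as a linear span\<close>

text \<open>For an ideal \<open>A\<close> this is a \<open>K\<close>-linear span, although no scalars appear: nonzero multiples of
  monomials and binomials of \<open>A\<close> are again monomials and binomials of \<open>A\<close>. Keeping the generators in a
  parameter \<open>A\<close> that need not be an ideal allows to restrict their supports.\<close>

inductive_set bin_span :: "('x, 'k::field) mpoly set \<Rightarrow> ('x, 'k) mpoly set"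
  for A :: "('x, 'k) mpoly set" where
  zero: "0 \<in> bin_span A"
| add: "g \<in> A \<Longrightarrow> is_monomial g \<or> is_binomial g \<Longrightarrow> f \<in> bin_span A \<Longrightarrow> g + f \<in> bin_span A"

lemma bin_span_base: "g \<in> A \<Longrightarrow> is_monomial g \<or> is_binomial g \<Longrightarrow> g \<in> bin_span A"
  using bin_span.add[OF _ _ bin_span.zero] by fastforce

lemma bin_span_mono:
  assumes "f \<in> bin_span A" "\<And>g. g \<in> A \<Longrightarrow> is_monomial g \<or> is_binomial g \<Longrightarrow> g \<in> B"
  shows "f \<in> bin_span B"
  using assms(1) by induction (auto intro: bin_span.intros assms(2))

lemma bin_span_add:
  assumes "f \<in> bin_span A" "h \<in> bin_span A"
  shows "f + h \<in> bin_span A"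
  using assms(1) by induction (auto intro: bin_span.intros assms(2) simp: add.assoc)

lemma bin_span_sum:
  "(\<And>i. i \<in> B \<Longrightarrow> h i \<in> bin_span A) \<Longrightarrow> sum h B \<in> bin_span A"
  by (induction B rule: infinite_finite_induct) (auto intro: bin_span.zero bin_span_add)

lemma bin_span_subset:
  assumes "0 \<in> B" "\<And>f g. f \<in> B \<Longrightarrow> g \<in> B \<Longrightarrow> f + g \<in> B"
    and "\<And>g. g \<in> A \<Longrightarrow> is_monomial g \<or> is_binomial g \<Longrightarrow> g \<in> B"
  shows "bin_span A \<subseteq> B"
proof
  fix f assume "f \<in> bin_span A"
  then show "f \<in> B" by induction (auto intro: assms)
qed

lemma single_mult_monomial_or_binomial:
  fixes g :: "('x, 'k::field) mpoly"
  assumes "is_monomial g \<or> is_binomial g" "c \<noteq> 0"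
  shows "is_monomial (Poly_Mapping.single t c * g) \<or> is_binomial (Poly_Mapping.single t c * g)"
  using assms(1)
proof
  assume "is_monomial g"
  then have "is_monomial (Poly_Mapping.single t c * g)"
    using assms(2) by (auto simp: is_monomial_def mult_single) (metis mult_eq_0_iff)
  then show ?thesis ..
next
  assume "is_binomial g"
  then obtain a b u v where "a \<noteq> 0" "b \<noteq> 0"
      "g = Poly_Mapping.single u a + Poly_Mapping.single v b"
    by (auto simp: is_binomial_def)
  then have "Poly_Mapping.single t c * g
      = Poly_Mapping.single (t + u) (c * a) + Poly_Mapping.single (t + v) (c * b)"
    and "c * a \<noteq> 0" "c * b \<noteq> 0"
    using assms(2) by (simp_all add: distrib_left mult_single)
  then show ?thesis
    unfolding is_binomial_def by blast
qed

lemma bin_span_ideal: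
  fixes A :: "('x, 'k::field) mpoly set"
  assumes A: "ideal A (poly_ring Y)"
  shows "ideal (bin_span A) (poly_ring Y)"
proof -
  have single_mult: "Poly_Mapping.single t c * f \<in> bin_span A"
    if "f \<in> bin_span A" "Poly_Mapping.keys t \<subseteq> Y" for f t c
    using that(1)
  proof induction
    case zero
    then show ?case by (simp add: bin_span.zero)
  next
    case (add g f)
    have "Poly_Mapping.single t c * g \<in> bin_span A"
    proof (cases "c = 0")
      case True
      then show ?thesis by (simp add: bin_span.zero)
    next
      case False
      have "Poly_Mapping.single t c * g \<in> A"
        using A add(1) single_in_carrier[OF that(2)] unfolding poly_ideal_iff by blast
      then show ?thesis
        using single_mult_monomial_or_binomial[OF add(2) False] bin_span_base by blast
    qed
    then show ?case
      using add.IH by (simp add: distrib_left bin_span_add)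
  qed
  have mult: "h * f \<in> bin_span A" if "f \<in> bin_span A" "h \<in> carrier (poly_ring Y)" for f h
  proof -
    have "h * f = (\<Sum>t\<in>Poly_Mapping.keys h. Poly_Mapping.single t (Poly_Mapping.lookup h t)) * f"
      by (simp flip: poly_mapping_eq_sum_single)
    also have "\<dots> = (\<Sum>t\<in>Poly_Mapping.keys h. Poly_Mapping.single t (Poly_Mapping.lookup h t) * f)"
      by (simp add: sum_distrib_right)
    also have "\<dots> \<in> bin_span A"
      using that by (intro bin_span_sum single_mult) (auto simp: carrier_poly_ring)
    finally show ?thesis .
  qed
  have "bin_span A \<subseteq> A"
    using A by (intro bin_span_subset) (auto simp: poly_ideal_iff)
  then show ?thesis
    using A mult unfolding poly_ideal_iff by (auto intro: bin_span.zero bin_span_add)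
qed

text \<open>A multiple of a monomial or binomial by a term is again one, so passing from the additive
  span to the generated ideal adds nothing.\<close>

lemma Bin_eq_bin_span:
  assumes A: "ideal A (poly_ring Y)"
  shows "Bin Y A = bin_span A"
proof
  let ?G = "{f \<in> A. is_monomial f \<or> is_binomial f}"
  have G: "?G \<subseteq> carrier (poly_ring Y)"
    using A by (auto simp: poly_ideal_iff)
  show "Bin Y A \<subseteq> bin_span A"
    unfolding Bin_def
    by (intro ring.genideal_minimal[OF ring_poly_ring] bin_span_ideal A) (auto intro: bin_span_base)
  have "ideal (Bin Y A) (poly_ring Y)" "?G \<subseteq> Bin Y A"
    unfolding Bin_def
    using ring.genideal_ideal[OF ring_poly_ring G] ring.genideal_self[OF ring_poly_ring G] by blast+
  then show "bin_span A \<subseteq> Bin Y A"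
    by (intro bin_span_subset) (auto simp: poly_ideal_iff)
qed

section \<open>Decomposition inside the support\<close>

text \<open>Suppose that the term \<open>t\<close> is not in \<open>A\<close>. For each term \<open>u\<close> that is a scalar multiple of \<open>t\<close>
  modulo \<open>A\<close> the scalar \<open>d u\<close> is then unique. With \<open>d u = 0\<close> for the other terms, \<open>d\<close> extends to a
  linear functional that vanishes on the monomials and binomials of \<open>A\<close>, hence on \<open>f\<close>. Since
  \<open>d t = 1\<close> and \<open>t\<close> occurs in \<open>f\<close>, the value \<open>0\<close> requires another term \<open>u\<close> of \<open>f\<close> with \<open>d u \<noteq> 0\<close>,
  and \<open>u - d u t\<close> is the binomial that cancels \<open>t\<close>.\<close>

lemma cancel_term_in_support:
  fixes A :: "('x, 'k::field) mpoly set"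
  assumes A: "ideal A (poly_ring Y)" and f: "f \<in> bin_span A" and t: "t \<in> Poly_Mapping.keys f"
  obtains g where "g \<in> A" "is_monomial g \<or> is_binomial g"
    "Poly_Mapping.keys g \<subseteq> Poly_Mapping.keys f"
    "Poly_Mapping.lookup g t = Poly_Mapping.lookup f t"
proof (cases "Poly_Mapping.single t 1 \<in> A")
  case True
  let ?c = "Poly_Mapping.lookup f t"
  have c: "?c \<noteq> 0" using t by (simp add: in_keys_iff)
  have "Poly_Mapping.single 0 ?c * Poly_Mapping.single t 1 \<in> A"
    using A True single_in_carrier[of 0 Y ?c] unfolding poly_ideal_iff by simp
  then have "Poly_Mapping.single t ?c \<in> A" by (simp add: mult_single)
  moreover have "is_monomial (Poly_Mapping.single t ?c)"
    using c by (auto simp: is_monomial_def)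
  ultimately show thesis
    using t by (intro that[of "Poly_Mapping.single t ?c"]) auto
next
  case t_notin: False
  have scale: "Poly_Mapping.single 0 c * g \<in> A" if "g \<in> A" for c g
    using A that single_in_carrier[of 0 Y c] unfolding poly_ideal_iff by simp
  define P where "P u c \<longleftrightarrow> Poly_Mapping.single u 1 - Poly_Mapping.single t c \<in> A" for u c
  have P_unique: "c = c'" if "P u c" "P u c'" for u c c'
  proof (rule ccontr)
    assume ne: "c \<noteq> c'"
    have "(Poly_Mapping.single u 1 - Poly_Mapping.single t c')
        - (Poly_Mapping.single u 1 - Poly_Mapping.single t c) \<in> A"
      using that unfolding P_def by (rule poly_ideal_diff[OF A, rotated])
    then have "Poly_Mapping.single t (c - c') \<in> A"
      by (simp add: single_diff)
    from scale[OF this, of "1 / (c - c')"] show False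
      using t_notin ne by (simp add: mult_single)
  qed
  \<comment> \<open>A term \<open>u \<in> A\<close> satisfies \<open>P u 0\<close>, in accordance with the default value \<open>0\<close>.\<close>
  define d where "d u = (if \<exists>c. P u c then SOME c. P u c else 0)" for u
  have d_eq: "d u = c" if "P u c" for u c
    using that P_unique unfolding d_def by (auto intro: some_equality)
  have P_d: "P u (d u)" if "d u \<noteq> 0" for u
    using that unfolding d_def by (metis someI)
  define \<phi> where "\<phi> g = (\<Sum>u\<in>Poly_Mapping.keys g. Poly_Mapping.lookup g u * d u)" for g
  have \<phi>_superset: "\<phi> g = (\<Sum>u\<in>B. Poly_Mapping.lookup g u * d u)"
    if "finite B" "Poly_Mapping.keys g \<subseteq> B" for g B
    unfolding \<phi>_def using that by (intro sum.mono_neutral_left) (auto simp: in_keys_iff)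
  have \<phi>_add: "\<phi> (g + h) = \<phi> g + \<phi> h" for g h
  proof -
    let ?B = "Poly_Mapping.keys g \<union> Poly_Mapping.keys h"
    have "Poly_Mapping.keys (g + h) \<subseteq> ?B" by (rule Poly_Mapping.keys_add)
    then show ?thesis
      using \<phi>_superset[of ?B]
      by (simp add: lookup_add distrib_right sum.distrib)
  qed
  have \<phi>_single: "\<phi> (Poly_Mapping.single u a) = a * d u" for u a
    by (simp add: \<phi>_def)
  have proportional: "P v (- (a / b) * c)"
    if ab: "Poly_Mapping.single u a + Poly_Mapping.single v b \<in> A" and "b \<noteq> 0" and "P u c"
    for u v a b c
  proof -
    have "Poly_Mapping.single 0 (1 / b) * (Poly_Mapping.single u a + Poly_Mapping.single v b)
        - Poly_Mapping.single 0 (a / b) * (Poly_Mapping.single u 1 - Poly_Mapping.single t c) \<in> A"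
      using poly_ideal_diff[OF A scale[OF ab] scale[OF \<open>P u c\<close>[unfolded P_def]]] .
    moreover have "Poly_Mapping.single 0 (1 / b) * (Poly_Mapping.single u a + Poly_Mapping.single v b)
        - Poly_Mapping.single 0 (a / b) * (Poly_Mapping.single u 1 - Poly_Mapping.single t c)
        = Poly_Mapping.single v 1 - Poly_Mapping.single t (- (a / b) * c)"
      using \<open>b \<noteq> 0\<close> by (simp add: algebra_simps mult_single single_uminus)
    ultimately show ?thesis unfolding P_def by simp
  qed
  have \<phi>_gen: "\<phi> g = 0" if "g \<in> A" "is_monomial g \<or> is_binomial g" for g
    using that(2)
  proof
    assume "is_monomial g"
    then obtain a u where au: "a \<noteq> 0" "g = Poly_Mapping.single u a"
      by (auto simp: is_monomial_def)
    then have "P u 0"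
      using scale[OF that(1), of "1 / a"] by (simp add: P_def mult_single)
    then show ?thesis using au d_eq by (simp add: \<phi>_single)
  next
    assume "is_binomial g"
    then obtain a b u v where ab: "a \<noteq> 0" "b \<noteq> 0"
        "g = Poly_Mapping.single u a + Poly_Mapping.single v b"
      by (auto simp: is_binomial_def)
    show ?thesis
    proof (cases "\<exists>c. P u c")
      case True
      then obtain c where c: "P u c" by blast
      then have "P v (- (a / b) * c)" using proportional that(1) ab by simp
      then have "d v = - (a / b) * c" by (rule d_eq)
      then show ?thesis using d_eq[OF c] ab by (simp add: \<phi>_add \<phi>_single)
    next
      case False
      moreover have "\<not> (\<exists>c. P v c)"
        using False proportional[of v b u a] that(1) ab by (auto simp: add.commute)
      ultimately show ?thesis using ab by (simp add: d_def \<phi>_add \<phi>_single)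
    qed
  qed
  have "\<phi> f = 0"
    using f by induction (simp_all add: \<phi>_add \<phi>_gen, simp add: \<phi>_def)
  moreover have "\<phi> f = Poly_Mapping.lookup f t * d t
      + (\<Sum>u\<in>Poly_Mapping.keys f - {t}. Poly_Mapping.lookup f u * d u)"
    unfolding \<phi>_def using t by (simp add: sum.remove)
  moreover have "d t = 1"
    using A by (intro d_eq) (auto simp: P_def poly_ideal_iff)
  ultimately have "(\<Sum>u\<in>Poly_Mapping.keys f - {t}. Poly_Mapping.lookup f u * d u) \<noteq> 0"
    using t by (auto simp: in_keys_iff)
  then obtain u where u: "u \<in> Poly_Mapping.keys f" "u \<noteq> t" "d u \<noteq> 0"
    by (metis (no_types, lifting) DiffE insertI1 mult_zero_right sum.neutral)
  let ?c = "Poly_Mapping.lookup f t"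
  let ?g = "Poly_Mapping.single u (- ?c / d u) + Poly_Mapping.single t ?c"
  have c: "?c \<noteq> 0" using t by (simp add: in_keys_iff)
  have "Poly_Mapping.single 0 (- ?c / d u) * (Poly_Mapping.single u 1 - Poly_Mapping.single t (d u)) \<in> A"
    using P_d[OF u(3)] unfolding P_def by (rule scale)
  also have "Poly_Mapping.single 0 (- ?c / d u) * (Poly_Mapping.single u 1 - Poly_Mapping.single t (d u)) = ?g"
    using u(3) by (simp add: right_diff_distrib mult_single single_uminus)
  finally have gA: "?g \<in> A" .
  have "- ?c / d u \<noteq> 0" using c u(3) by simp
  with c have "is_binomial ?g" unfolding is_binomial_def by blast
  moreover have "Poly_Mapping.keys ?g \<subseteq> Poly_Mapping.keys f"
    using Poly_Mapping.keys_add[of "Poly_Mapping.single u (- ?c / d u)" "Poly_Mapping.single t ?c"]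
      t u(1) by (auto split: if_splits)
  moreover have "Poly_Mapping.lookup ?g t = ?c"
    using u(2) by (simp add: lookup_add lookup_single)
  ultimately show thesis using gA that by blast
qed

text \<open>Cancelling the terms of \<open>f\<close> one at a time never creates a new one. This is what makes the
  intersection of a binomial ideal with a monomial ideal binomial.\<close>

lemma bin_span_in_support:
  fixes A :: "('x, 'k::field) mpoly set"
  assumes A: "ideal A (poly_ring Y)"
  shows "f \<in> bin_span A \<Longrightarrow> f \<in> bin_span {g \<in> A. Poly_Mapping.keys g \<subseteq> Poly_Mapping.keys f}"
proof (induction "card (Poly_Mapping.keys f)" arbitrary: f rule: less_induct)
  case less
  show ?case
  proof (cases "f = 0")
    case True
    then show ?thesis by (simp add: bin_span.zero)
  next
    case False
    then have "Poly_Mapping.keys f \<noteq> {}"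
      by (metis in_keys_iff lookup_zero poly_mapping_eqI empty_iff)
    then obtain t where t: "t \<in> Poly_Mapping.keys f" by blast
    then obtain g where g: "g \<in> A" "is_monomial g \<or> is_binomial g"
      "Poly_Mapping.keys g \<subseteq> Poly_Mapping.keys f"
      "Poly_Mapping.lookup g t = Poly_Mapping.lookup f t"
      using cancel_term_in_support[OF A less.prems] by blast
    have sub: "Poly_Mapping.keys (f - g) \<subseteq> Poly_Mapping.keys f"
      using keys_diff[of f g] g(3) by blast
    moreover have "t \<notin> Poly_Mapping.keys (f - g)"
      using g(4) by (simp add: in_keys_iff lookup_minus)
    ultimately have "card (Poly_Mapping.keys (f - g)) < card (Poly_Mapping.keys f)"
      using t by (intro psubset_card_mono) auto
    moreover have "f - g \<in> bin_span A"
      using poly_ideal_diff[OF bin_span_ideal[OF A] less.prems] bin_span_base g(1,2) by blast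
    ultimately have "f - g \<in> bin_span {h \<in> A. Poly_Mapping.keys h \<subseteq> Poly_Mapping.keys (f - g)}"
      by (rule less.hyps)
    then have "f - g \<in> bin_span {h \<in> A. Poly_Mapping.keys h \<subseteq> Poly_Mapping.keys f}"
      using sub by (elim bin_span_mono) auto
    then have "g + (f - g) \<in> bin_span {h \<in> A. Poly_Mapping.keys h \<subseteq> Poly_Mapping.keys f}"
      using g by (intro bin_span.add) auto
    then show ?thesis by simp
  qed
qed

section \<open>Ideals generated by variables\<close>

lemma var_ideal_ideal:
  "Z \<subseteq> X \<Longrightarrow> ideal (var_ideal X Z :: ('x, 'k::field) mpoly set) (poly_ring X)"
  unfolding var_ideal_def
  by (rule ring.genideal_ideal[OF ring_poly_ring]) (auto intro: Var_in_carrier)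

lemma Var_in_var_ideal:
  assumes "Z \<subseteq> X" "x \<in> Z"
  shows "Var x \<in> (var_ideal X Z :: ('x, 'k::field) mpoly set)"
proof -
  have "Var ` Z \<subseteq> carrier (poly_ring X :: ('x, 'k) mpoly ring)"
    using assms(1) by (auto intro: Var_in_carrier)
  then have "Var ` Z \<subseteq> (var_ideal X Z :: ('x, 'k) mpoly set)"
    unfolding var_ideal_def by (rule ring.genideal_self[OF ring_poly_ring])
  then show ?thesis using assms(2) by blast
qed

lemma var_ideal_eq:
  fixes X Z :: "'x set"
  assumes Z: "Z \<subseteq> X"
  shows "(var_ideal X Z :: ('x, 'k::field) mpoly set) =
    {f \<in> carrier (poly_ring X). \<forall>t\<in>Poly_Mapping.keys f. Poly_Mapping.keys t \<inter> Z \<noteq> {}}"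
    (is "_ = ?M")
proof
  have mult: "h * f \<in> ?M" if h: "h \<in> carrier (poly_ring X)" and f: "f \<in> ?M" for f h
  proof -
    have "h * f \<in> carrier (poly_ring X)"
      using ring.ring_simprules(5)[OF ring_poly_ring[of X], of h f] h f by simp
    moreover have "Poly_Mapping.keys t \<inter> Z \<noteq> {}" if "t \<in> Poly_Mapping.keys (h * f)" for t
    proof -
      obtain u v where "v \<in> Poly_Mapping.keys f" "t = u + v"
        using Poly_Mapping.keys_mult[of h f] \<open>t \<in> _\<close> by blast
      then show ?thesis using f by (auto simp: keys_add_nat)
    qed
    ultimately show ?thesis by blast
  qed
  have add: "f + g \<in> ?M" if "f \<in> ?M" "g \<in> ?M" for f g
    using that Poly_Mapping.keys_add[of f g] unfolding carrier_poly_ring mem_Collect_eq by blast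
  have "0 \<in> ?M" by (simp add: carrier_poly_ring)
  then have "ideal ?M (poly_ring X)"
    unfolding poly_ideal_iff using mult add by (intro conjI ballI) (simp_all only:, blast)
  then show "var_ideal X Z \<subseteq> ?M"
    unfolding var_ideal_def using Z
    by (intro ring.genideal_minimal[OF ring_poly_ring]) (auto intro: Var_in_carrier, simp add: Var_def)
  show "?M \<subseteq> var_ideal X Z"
  proof
    fix f assume f: "f \<in> ?M"
    have I: "ideal (var_ideal X Z :: ('x, 'k) mpoly set) (poly_ring X)"
      by (rule var_ideal_ideal[OF Z])
    have "Poly_Mapping.single t (Poly_Mapping.lookup f t) \<in> var_ideal X Z"
      if t: "t \<in> Poly_Mapping.keys f" for t
    proof -
      let ?c = "Poly_Mapping.lookup f t"
      obtain x where x: "x \<in> Poly_Mapping.keys t" "x \<in> Z" using f t by blast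
      let ?u = "t - Poly_Mapping.single x 1"
      have "t = ?u + Poly_Mapping.single x 1"
        using x(1) by (intro poly_mapping_eqI)
          (auto simp: lookup_add lookup_minus lookup_single when_def in_keys_iff)
      then have eq: "Poly_Mapping.single t ?c = Poly_Mapping.single ?u ?c * Var x"
        by (simp add: Var_def mult_single)
      have "Poly_Mapping.keys ?u \<subseteq> Poly_Mapping.keys t"
        by (auto simp: in_keys_iff lookup_minus)
      then have "Poly_Mapping.single ?u ?c \<in> carrier (poly_ring X)"
        using f t by (intro single_in_carrier) (auto simp: carrier_poly_ring)
      moreover have "Var x \<in> var_ideal X Z"
        using Var_in_var_ideal[OF Z x(2)] .
      ultimately show ?thesis
        using I unfolding eq poly_ideal_iff by blast
    qed
    then have "(\<Sum>t\<in>Poly_Mapping.keys f. Poly_Mapping.single t (Poly_Mapping.lookup f t)) \<in> var_ideal X Z"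
      by (rule poly_ideal_sum[OF I])
    then show "f \<in> var_ideal X Z"
      by (simp flip: poly_mapping_eq_sum_single)
  qed
qed

section \<open>Monomials and binomials in a prime ideal\<close>

lemma prime_prod:
  fixes p :: "('x, 'k::field) mpoly set"
  assumes p: "primeideal p (poly_ring X)" and "finite B"
    and "\<And>i. i \<in> B \<Longrightarrow> h i \<in> carrier (poly_ring X)" and "(\<Prod>i\<in>B. h i) \<in> p"
  shows "\<exists>i\<in>B. h i \<in> p"
proof -
  interpret primeideal p "poly_ring X" by (rule p)
  have one: "1 \<notin> p"
    using one_imp_carrier I_notcarr by auto
  have prod_closed: "finite C \<Longrightarrow> (\<And>i. i \<in> C \<Longrightarrow> h i \<in> carrier (poly_ring X)) \<Longrightarrow>
      (\<Prod>i\<in>C. h i) \<in> carrier (poly_ring X)" for C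
  proof (induction C rule: finite_induct)
    case empty
    then show ?case using one_closed by simp
  next
    case (insert i C)
    then show ?case using m_closed[of "h i" "\<Prod>i\<in>C. h i"] by simp
  qed
  show ?thesis using assms(2-)
  proof (induction B rule: finite_induct)
    case empty
    then show ?case using one by simp
  next
    case (insert i B)
    then have "h i \<in> p \<or> (\<Prod>i\<in>B. h i) \<in> p"
      using I_prime[of "h i" "\<Prod>i\<in>B. h i"] prod_closed[of B] by simp
    then show ?case using insert by blast
  qed
qed

text \<open>Primeness applies because \<open>t\<close> is a product of powers of its variables and \<open>a\<close> is a unit.\<close>

lemma prime_term_variable:
  fixes p :: "('x, 'k::field) mpoly set"
  assumes p: "primeideal p (poly_ring X)" and t: "Poly_Mapping.keys t \<subseteq> X"
    and a: "a \<noteq> 0" and mem: "Poly_Mapping.single t a \<in> p"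
  shows "\<exists>x\<in>Poly_Mapping.keys t. Var x \<in> p"
proof -
  interpret primeideal p "poly_ring X" by (rule p)
  have one: "1 \<notin> p"
    using one_imp_carrier I_notcarr by auto
  let ?pw = "\<lambda>x. Poly_Mapping.single (Poly_Mapping.single x (Poly_Mapping.lookup t x)) 1"
  have prod_single: "finite B \<Longrightarrow> (\<Prod>x\<in>B. Poly_Mapping.single (h x) (1::'k)) = Poly_Mapping.single (\<Sum>x\<in>B. h x) 1"
    for B and h :: "'x \<Rightarrow> 'x \<Rightarrow>\<^sub>0 nat"
    by (induction B rule: finite_induct) (simp_all add: mult_single)
  have "Poly_Mapping.single 0 (1 / a) * Poly_Mapping.single t a \<in> p"
    using I_l_closed[OF mem single_in_carrier[of 0 X "1 / a"]] by simp
  then have "Poly_Mapping.single t 1 \<in> p"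
    using a by (simp add: mult_single)
  then have "(\<Prod>x\<in>Poly_Mapping.keys t. ?pw x) \<in> p"
    by (simp add: prod_single flip: poly_mapping_eq_sum_single)
  moreover have "?pw x \<in> carrier (poly_ring X)" if "x \<in> Poly_Mapping.keys t" for x
    using that t by (intro single_in_carrier) auto
  ultimately obtain x where x: "x \<in> Poly_Mapping.keys t" "?pw x \<in> p"
    using prime_prod[OF p, of "Poly_Mapping.keys t" ?pw] by auto
  have "Var x \<in> p" if "Poly_Mapping.single (Poly_Mapping.single x n) 1 \<in> p" for n
    using that
  proof (induction n)
    case 0
    then show ?case using one by simp
  next
    case (Suc n)
    have "Poly_Mapping.single (Poly_Mapping.single x (Suc n)) (1::'k)
        = Var x * Poly_Mapping.single (Poly_Mapping.single x n) 1"
      by (simp add: Var_def mult_single flip: single_add)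
    moreover have "Poly_Mapping.single (Poly_Mapping.single x n) (1::'k) \<in> carrier (poly_ring X)"
      using x(1) t by (intro single_in_carrier) auto
    moreover have "Var x \<in> carrier (poly_ring X :: ('x, 'k) mpoly ring)"
      using x(1) t by (intro Var_in_carrier) auto
    ultimately show ?case
      using I_prime[of "Var x" "Poly_Mapping.single (Poly_Mapping.single x n) 1"] Suc by auto
  qed
  then show ?thesis using x by blast
qed

text \<open>For a prime ideal, the colon ideal by a monomial is the ideal itself iff the monomial is not
  in it, that is, iff no variable of the monomial is in it. So there is only one maximal set.\<close>

lemma maximal_var_set_prime:
  fixes p :: "('x, 'k::field) mpoly set"
  assumes X: "finite X" and p: "primeideal p (poly_ring X)" and Y: "maximal_var_set X p Y"
  shows "Y = {x \<in> X. Var x \<notin> p}"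
proof -
  interpret primeideal p "poly_ring X" by (rule p)
  have one: "1 \<notin> p"
    using one_imp_carrier I_notcarr by auto
  have colon: "prod_colon_eq X p Z \<longleftrightarrow> (\<forall>x\<in>Z. Var x \<notin> p)" if Z: "Z \<subseteq> X" for Z
  proof -
    let ?m = "\<Prod>x\<in>Z. Var x :: ('x, 'k) mpoly"
    have fin: "finite Z" using X Z finite_subset by blast
    have m_carrier: "(\<Prod>x\<in>B. Var x) \<in> carrier (poly_ring X :: ('x, 'k) mpoly ring)"
      if "finite B" "B \<subseteq> X" for B
      using that
    proof (induction B rule: finite_induct)
      case empty
      then show ?case using one_closed by simp
    next
      case (insert x B)
      then show ?case using m_closed[OF Var_in_carrier[of x X]] by simp
    qed
    have m_in_p: "?m \<in> p \<longleftrightarrow> (\<exists>x\<in>Z. Var x \<in> p)"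
    proof
      assume "?m \<in> p"
      then show "\<exists>x\<in>Z. Var x \<in> p"
        by (intro prime_prod[OF p fin] Var_in_carrier subsetD[OF Z])
    next
      assume "\<exists>x\<in>Z. Var x \<in> p"
      then obtain x where x: "x \<in> Z" "Var x \<in> p" by blast
      have "?m = Var x * (\<Prod>y\<in>Z - {x}. Var y)"
        using fin x(1) by (rule prod.remove)
      then show "?m \<in> p"
        using I_r_closed[OF x(2) m_carrier[of "Z - {x}"]] fin Z by auto
    qed
    let ?M = "genideal (poly_ring X) {?m}"
    have m: "?m \<in> carrier (poly_ring X)" by (rule m_carrier[OF fin Z])
    have M: "ideal ?M (poly_ring X)" "?m \<in> ?M"
      using genideal_ideal[of "{?m}"] genideal_self'[OF m] m by auto
    have p_ideal: "ideal p (poly_ring X)" by (rule ideal_axioms)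
    show ?thesis
    proof (cases "?m \<in> p")
      case True
      have "?M \<subseteq> p"
        using True by (intro genideal_minimal p_ideal) simp
      then have "1 \<in> ideal_colon (poly_ring X) p ?M"
        using one_closed by (auto simp: ideal_colon_def)
      then show ?thesis
        using True m_in_p one by (auto simp: prod_colon_eq_def)
    next
      case False
      have "ideal_colon (poly_ring X) p ?M = p"
      proof
        show "ideal_colon (poly_ring X) p ?M \<subseteq> p"
          using M(2) m False I_prime by (auto simp: ideal_colon_def)
        show "p \<subseteq> ideal_colon (poly_ring X) p ?M"
          using M(1) I_r_closed Icarr by (auto simp: ideal_colon_def poly_ideal_iff)
      qed
      then show ?thesis
        using False m_in_p by (auto simp: prod_colon_eq_def)
    qed
  qed
  have "Y \<subseteq> {x \<in> X. Var x \<notin> p}"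
    using Y colon by (auto simp: maximal_var_set_def)
  moreover have "prod_colon_eq X p {x \<in> X. Var x \<notin> p}"
    by (subst colon) auto
  ultimately show ?thesis
    using Y unfolding maximal_var_set_def by blast
qed

section \<open>The binomial part of a radical ideal\<close>

lemma single_in_prime_iff:
  fixes p :: "('x, 'k::field) mpoly set"
  assumes p: "primeideal p (poly_ring X)"
    and t: "Poly_Mapping.keys t \<subseteq> X" and a: "a \<noteq> 0"
  shows "Poly_Mapping.single t a \<in> p \<longleftrightarrow>
    Poly_Mapping.single t a \<in> (var_ideal X {x \<in> X. Var x \<in> p} :: ('x, 'k) mpoly set)"
proof
  assume "Poly_Mapping.single t a \<in> p"
  then obtain x where "x \<in> Poly_Mapping.keys t" "Var x \<in> p"
    using prime_term_variable[OF p t a] by blast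
  then show "Poly_Mapping.single t a \<in> (var_ideal X {x \<in> X. Var x \<in> p} :: ('x, 'k) mpoly set)"
    using t by (subst var_ideal_eq) (auto simp: carrier_poly_ring)
next
  have "ideal p (poly_ring X)"
    using p by (rule primeideal.axioms(1))
  then have "(var_ideal X {x \<in> X. Var x \<in> p} :: ('x, 'k) mpoly set) \<subseteq> p"
    unfolding var_ideal_def by (intro ring.genideal_minimal[OF ring_poly_ring]) auto
  then show "Poly_Mapping.single t a \<in> (var_ideal X {x \<in> X. Var x \<in> p} :: ('x, 'k) mpoly set)
      \<Longrightarrow> Poly_Mapping.single t a \<in> p" by blast
qed

text \<open>If one term of a binomial of \<open>p\<close> is in \<open>p\<close>, so is the other one, and both are multiples of
  variables of \<open>p\<close>. If neither is, no variable of \<open>p\<close> occurs in the binomial.\<close>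

lemma prime_monomial_or_binomial_cases:
  fixes p :: "('x, 'k::field) mpoly set"
  assumes p: "primeideal p (poly_ring X)"
    and f: "f \<in> p" "is_monomial f \<or> is_binomial f"
  shows "f \<in> var_ideal X {x \<in> X. Var x \<in> p} \<or> f \<in> carrier (poly_ring {x \<in> X. Var x \<notin> p})"
proof -
  let ?Z = "{x \<in> X. Var x \<in> p}"
  have p_ideal: "ideal p (poly_ring X)"
    using p by (rule primeideal.axioms(1))
  have f_carrier: "f \<in> carrier (poly_ring X)"
    using p_ideal f(1) unfolding poly_ideal_iff by blast
  have var: "Poly_Mapping.single t c \<in> var_ideal X ?Z"
    if "Poly_Mapping.single t c \<in> p" "Poly_Mapping.keys t \<subseteq> X" "c \<noteq> 0" for t c
    using single_in_prime_iff[OF p] that by blast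
  have V: "ideal (var_ideal X ?Z :: ('x, 'k) mpoly set) (poly_ring X)"
    by (rule var_ideal_ideal) blast
  have V_sub: "(var_ideal X ?Z :: ('x, 'k) mpoly set) \<subseteq> p"
    unfolding var_ideal_def
    by (intro ring.genideal_minimal[OF ring_poly_ring p_ideal]) auto
  consider t c where "c \<noteq> 0" "f = Poly_Mapping.single t c"
    | "f = 0"
    | s t a b where "s \<noteq> t" "a \<noteq> 0" "b \<noteq> 0"
      "f = Poly_Mapping.single s a + Poly_Mapping.single t b"
    using f(2) unfolding is_monomial_def is_binomial_def by (metis single_add single_zero)
  then show ?thesis
  proof cases
    case 1
    then have "Poly_Mapping.keys t \<subseteq> X" using f_carrier by (simp add: carrier_poly_ring)
    then show ?thesis using 1 f(1) var by blast
  next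
    case 2
    then show ?thesis by (simp add: carrier_poly_ring)
  next
    case 3
    have keys: "Poly_Mapping.keys f = {s, t}"
      using 3 by (auto simp: in_keys_iff lookup_add lookup_single when_def split: if_splits)
    then have st: "Poly_Mapping.keys s \<subseteq> X" "Poly_Mapping.keys t \<subseteq> X"
      using f_carrier by (auto simp: carrier_poly_ring)
    show ?thesis
    proof (cases "Poly_Mapping.single s a \<in> p \<or> Poly_Mapping.single t b \<in> p")
      case True
      have "Poly_Mapping.single t b = f - Poly_Mapping.single s a"
        "Poly_Mapping.single s a = f - Poly_Mapping.single t b"
        using 3 by simp_all
      then have "Poly_Mapping.single s a \<in> p \<and> Poly_Mapping.single t b \<in> p"
        using True poly_ideal_diff[OF p_ideal f(1)] by metis
      then have "Poly_Mapping.single s a \<in> var_ideal X ?Z" "Poly_Mapping.single t b \<in> var_ideal X ?Z"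
        using var st 3 by blast+
      then have "f \<in> var_ideal X ?Z"
        using V 3(4) unfolding poly_ideal_iff by blast
      then show ?thesis ..
    next
      case False
      have avoid: "Poly_Mapping.keys u \<subseteq> {x \<in> X. Var x \<notin> p}"
        if u: "Poly_Mapping.keys u \<subseteq> X" and "Poly_Mapping.single u c \<notin> p" for u c
      proof -
        have "(Poly_Mapping.single u c :: ('x, 'k) mpoly) \<notin> var_ideal X ?Z"
          using V_sub that by blast
        then have "Poly_Mapping.keys u \<inter> ?Z = {}"
          using u by (subst (asm) var_ideal_eq) (auto simp: carrier_poly_ring split: if_splits)
        then show ?thesis using u by blast
      qed
      have "f \<in> carrier (poly_ring {x \<in> X. Var x \<notin> p})"
        using avoid[OF st(1), of a] avoid[OF st(2), of b] False by (simp add: carrier_poly_ring keys)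
      then show ?thesis ..
    qed
  qed
qed

lemma ideal_restrict:
  fixes p :: "('x, 'k::field) mpoly set"
  assumes p: "ideal p (poly_ring X)" and Y: "Y \<subseteq> X"
  shows "ideal (p \<inter> carrier (poly_ring Y)) (poly_ring Y)"
proof -
  have sub: "carrier (poly_ring Y) \<subseteq> (carrier (poly_ring X) :: ('x, 'k) mpoly set)"
    using Y unfolding carrier_poly_ring subset_iff by blast
  interpret R: ring "poly_ring Y :: ('x, 'k) mpoly ring" by (rule ring_poly_ring)
  show ?thesis
    using p sub R.zero_closed R.a_closed R.m_closed
    unfolding poly_ideal_iff by (intro conjI ballI) (auto simp: subset_iff)
qed

lemma ideal_ext_ideal:
  assumes "J \<subseteq> carrier (poly_ring X)"
  shows "ideal (ideal_ext X J) (poly_ring X)" "J \<subseteq> ideal_ext X J"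
  unfolding ideal_ext_def
  using ring.genideal_ideal[OF ring_poly_ring assms] ring.genideal_self[OF ring_poly_ring assms] .

lemma Bin_prime:
  fixes p :: "('x, 'k::field) mpoly set"
  assumes p: "primeideal p (poly_ring X)"
  defines "Y \<equiv> {x \<in> X. Var x \<notin> p}"
  defines "J \<equiv> Bin Y (p \<inter> carrier (poly_ring Y))"
  shows "J \<subseteq> p" "J \<subseteq> carrier (poly_ring X)"
    and "Bin X p = ideal_ext X J <+>\<^bsub>poly_ring X\<^esub> var_ideal X (X - Y)"
proof -
  have p_ideal: "ideal p (poly_ring X)"
    using p by (rule primeideal.axioms(1))
  have YX: "Y \<subseteq> X" unfolding Y_def by blast
  have Z: "X - Y = {x \<in> X. Var x \<in> p}" unfolding Y_def by blast
  have J: "J = bin_span (p \<inter> carrier (poly_ring Y))"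
    unfolding J_def by (rule Bin_eq_bin_span[OF ideal_restrict[OF p_ideal YX]])
  have Bin_p: "Bin X p = bin_span p" by (rule Bin_eq_bin_span[OF p_ideal])
  have Bin_ideal: "ideal (Bin X p) (poly_ring X)"
    unfolding Bin_p by (rule bin_span_ideal[OF p_ideal])
  have J_Bin: "J \<subseteq> Bin X p"
    unfolding J Bin_p by (auto elim: bin_span_mono)
  have "bin_span p \<subseteq> p"
    using p_ideal by (intro bin_span_subset) (auto simp: poly_ideal_iff)
  then show "J \<subseteq> p" using J_Bin Bin_p by blast
  show J_carrier: "J \<subseteq> carrier (poly_ring X)"
    using J_Bin Bin_ideal unfolding poly_ideal_iff by blast
  let ?E = "ideal_ext X J" and ?V = "var_ideal X (X - Y) :: ('x, 'k) mpoly set"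
  have E: "ideal ?E (poly_ring X)" "J \<subseteq> ?E"
    by (rule ideal_ext_ideal[OF J_carrier])+
  have V: "ideal ?V (poly_ring X)" by (rule var_ideal_ideal) blast
  have sum: "f \<in> ?E <+>\<^bsub>poly_ring X\<^esub> ?V \<longleftrightarrow> (\<exists>e\<in>?E. \<exists>v\<in>?V. f = e + v)" for f
    by (auto simp: set_add_def')
  show "Bin X p = ?E <+>\<^bsub>poly_ring X\<^esub> ?V"
  proof
    have E0: "0 \<in> ?E" and V0: "0 \<in> ?V"
      using E(1) V unfolding poly_ideal_iff by blast+
    show "Bin X p \<subseteq> ?E <+>\<^bsub>poly_ring X\<^esub> ?V"
      unfolding Bin_p
    proof (rule bin_span_subset)
      show "0 \<in> ?E <+>\<^bsub>poly_ring X\<^esub> ?V"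
        unfolding sum using E0 V0 by force
    next
      fix f g assume "f \<in> ?E <+>\<^bsub>poly_ring X\<^esub> ?V" "g \<in> ?E <+>\<^bsub>poly_ring X\<^esub> ?V"
      then show "f + g \<in> ?E <+>\<^bsub>poly_ring X\<^esub> ?V"
        using ideal.axioms(1)[OF ring.add_ideals[OF ring_poly_ring E(1) V]]
          additive_subgroup.a_closed by fastforce
    next
      fix g assume g: "g \<in> p" "is_monomial g \<or> is_binomial g"
      show "g \<in> ?E <+>\<^bsub>poly_ring X\<^esub> ?V"
      proof (cases "g \<in> ?V")
        case True
        then show ?thesis unfolding sum using E0 by force
      next
        case False
        then have "g \<in> carrier (poly_ring Y)"
          using prime_monomial_or_binomial_cases[OF p g] unfolding Z unfolding Y_def by blast
        then have "g \<in> J"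
          unfolding J using g by (intro bin_span_base) auto
        then show ?thesis unfolding sum using E(2) V0 by force
      qed
    qed
    have "?E \<subseteq> Bin X p"
      unfolding ideal_ext_def by (intro ring.genideal_minimal[OF ring_poly_ring] Bin_ideal J_Bin)
    moreover have "?V \<subseteq> Bin X p"
      unfolding var_ideal_def
    proof (intro ring.genideal_minimal[OF ring_poly_ring] Bin_ideal subsetI)
      fix f :: "('x, 'k) mpoly" assume "f \<in> Var ` (X - Y)"
      then obtain x where x: "Var x \<in> p" "f = Var x" unfolding Z by blast
      have "is_monomial (Var x :: ('x, 'k) mpoly)"
        unfolding is_monomial_def Var_def by (rule exI[of _ 1]) auto
      then show "f \<in> Bin X p" unfolding Bin_p x(2) using x(1) by (intro bin_span_base) auto
    qed
    ultimately show "?E <+>\<^bsub>poly_ring X\<^esub> ?V \<subseteq> Bin X p"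
      using Bin_ideal unfolding sum[abs_def] poly_ideal_iff subset_iff sum by blast
  qed
qed

lemma ideal_Sum_poly_ring:
  fixes T :: "'i \<Rightarrow> ('x, 'k::field) mpoly set"
  assumes "finite B" "\<And>i. i \<in> B \<Longrightarrow> T i \<subseteq> carrier (poly_ring X)"
  shows "ideal_Sum (poly_ring X) B T = {sum h B | h. \<forall>i\<in>B. h i \<in> T i}"
proof -
  have "finsum (poly_ring X) h B = sum h B" if "\<forall>i\<in>B. h i \<in> T i" for h
    using assms that by (intro finsum_poly_ring) blast+
  then show ?thesis
    unfolding ideal_Sum_def by (intro Collect_cong iff_exI) auto
qed

theorem mainTheorem7:
  fixes X :: "'x set"
    and I :: "('x, 'k::field) mpoly set"
    and k :: nat
    and \<pp> :: "nat \<Rightarrow> ('x, 'k) mpoly set"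
    and Y :: "nat \<Rightarrow> 'x set"
    and J :: "nat \<Rightarrow> ('x, 'k) mpoly set"
  assumes "finite X"
    and "radical_ideal I (poly_ring X)"
    and "I \<noteq> carrier (poly_ring X)"
    and "prime_decomposition (poly_ring X) I k \<pp>"
    and "\<And>i. i \<in> {1..k} \<Longrightarrow> maximal_var_set X (\<pp> i) (Y i)"
    and "\<And>i. i \<in> {1..k} \<Longrightarrow> J i = Bin (Y i) (\<pp> i \<inter> carrier (poly_ring (Y i)))"
  shows "(\<forall>i\<in>{1..k}. Bin X (\<pp> i) = ideal_ext X (J i) <+>\<^bsub>poly_ring X\<^esub> var_ideal X (X - Y i))
    \<and> returned_ideal X k Y J = Bin X I"
proof -
  have prime: "primeideal (\<pp> i) (poly_ring X)" if "i \<in> {1..k}" for i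
    using assms(4) that unfolding prime_decomposition_def by blast
  have I: "I = ideal_Inter (poly_ring X) {1..k} \<pp>"
    using assms(4) unfolding prime_decomposition_def by blast
  have p_ideal: "ideal (\<pp> i) (poly_ring X)" if "i \<in> {1..k}" for i
    using prime[OF that] by (rule primeideal.axioms(1))
  have I_ideal: "ideal I (poly_ring X)"
    using assms(2) unfolding radical_ideal_def by blast
  have Y: "Y i = {x \<in> X. Var x \<notin> \<pp> i}" if "i \<in> {1..k}" for i
    by (rule maximal_var_set_prime[OF assms(1) prime[OF that] assms(5)[OF that]])
  have Z: "X - Y i = {x \<in> X. Var x \<in> \<pp> i}" if "i \<in> {1..k}" for i
    unfolding Y[OF that] by blast
  have J_sub_p: "J i \<subseteq> \<pp> i" and J_carrier: "J i \<subseteq> carrier (poly_ring X)"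
    and part1: "Bin X (\<pp> i) = ideal_ext X (J i) <+>\<^bsub>poly_ring X\<^esub> var_ideal X (X - Y i)"
    if "i \<in> {1..k}" for i
    using Bin_prime[OF prime[OF that], folded Y[OF that], folded assms(6)[OF that]] by blast+
  let ?V = "\<lambda>i. var_ideal X (X - Y i) :: ('x, 'k) mpoly set"
  let ?E = "\<lambda>i. ideal_ext X (J i)"
  have V_sub_p: "?V i \<subseteq> \<pp> i" if "i \<in> {1..k}" for i
    unfolding var_ideal_def Z[OF that]
    by (intro ring.genideal_minimal[OF ring_poly_ring p_ideal[OF that]]) auto
  have V_eq: "?V i = {f \<in> carrier (poly_ring X). \<forall>t\<in>Poly_Mapping.keys f. Poly_Mapping.keys t \<inter> (X - Y i) \<noteq> {}}" for i
    by (rule var_ideal_eq) blast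
  have E_sub_p: "?E i \<subseteq> \<pp> i" if "i \<in> {1..k}" for i
    unfolding ideal_ext_def
    by (intro ring.genideal_minimal[OF ring_poly_ring p_ideal[OF that]] J_sub_p that)
  have E_ideal: "ideal (?E i) (poly_ring X)" and J_sub_E: "J i \<subseteq> ?E i" if "i \<in> {1..k}" for i
    using ideal_ext_ideal[OF J_carrier[OF that]] by blast+
  let ?M = "\<lambda>S. ideal_Inter (poly_ring X) ({1..k} - S) ?V"
  let ?N = "\<lambda>S. ideal_Inter (poly_ring X) S ?E"
  have N_ideal: "ideal (?N S) (poly_ring X)" if "S \<subseteq> {1..k}" for S
    using that E_ideal by (intro poly_ideal_Inter) blast
  have J_empty: "J_sub X J {} = carrier (poly_ring X)"
    using ring.genideal_one[OF ring_poly_ring, of X] by (simp add: J_sub_def)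
  have J_nonempty: "J_sub X J S = bin_span (?N S)" if "S \<noteq> {}" "S \<subseteq> {1..k}" for S
    using that by (simp add: J_sub_def Bin_eq_bin_span[OF N_ideal])
  let ?T = "\<lambda>S. ?M S \<inter> J_sub X J S"
  have Bin_I: "Bin X I = bin_span I" by (rule Bin_eq_bin_span[OF I_ideal])
  have T_carrier: "?T S \<subseteq> carrier (poly_ring X)" for S
    by (auto simp: mem_ideal_Inter)
  have returned: "returned_ideal X k Y J = {sum h (Pow {1..k}) | h. \<forall>S\<in>Pow {1..k}. h S \<in> ?T S}"
    unfolding returned_ideal_def using T_carrier by (intro ideal_Sum_poly_ring) auto
  have M_support: "g \<in> ?M S"
    if "f \<in> ?M S" "g \<in> carrier (poly_ring X)" "Poly_Mapping.keys g \<subseteq> Poly_Mapping.keys f" for f g S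
    using that unfolding mem_ideal_Inter V_eq by blast
  have T_sub: "?T S \<subseteq> bin_span I" if S: "S \<subseteq> {1..k}" for S
  proof
    fix f assume f: "f \<in> ?T S"
    show "f \<in> bin_span I"
    proof (cases "S = {}")
      case True
      have "Poly_Mapping.single t (Poly_Mapping.lookup f t) \<in> bin_span I"
        if t: "t \<in> Poly_Mapping.keys f" for t
      proof (rule bin_span_base)
        let ?g = "Poly_Mapping.single t (Poly_Mapping.lookup f t)"
        have g_carrier: "?g \<in> carrier (poly_ring X)"
          using f T_carrier t by (intro single_in_carrier) (auto simp: carrier_poly_ring mem_ideal_Inter)
        have "?g \<in> ?M {}"
          by (rule M_support[of f]) (use f t True g_carrier in auto)
        then have "?g \<in> ?V i" if "i \<in> {1..k}" for i
          using that unfolding mem_ideal_Inter by simp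
        then have "?g \<in> \<pp> i" if "i \<in> {1..k}" for i
          by (rule subsetD[OF V_sub_p[OF that]]) (rule that)
        then show "?g \<in> I"
          using g_carrier by (simp add: I mem_ideal_Inter)
        show "is_monomial ?g \<or> is_binomial ?g"
          using t by (auto simp: is_monomial_def in_keys_iff)
      qed
      then have "(\<Sum>t\<in>Poly_Mapping.keys f. Poly_Mapping.single t (Poly_Mapping.lookup f t)) \<in> bin_span I"
        by (rule bin_span_sum)
      then show ?thesis by (simp flip: poly_mapping_eq_sum_single)
    next
      case False
      have "f \<in> bin_span (?N S)"
        using f J_nonempty[OF False S] by blast
      then have "f \<in> bin_span {g \<in> ?N S. Poly_Mapping.keys g \<subseteq> Poly_Mapping.keys f}"
        by (rule bin_span_in_support[OF N_ideal[OF S]])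
      then show ?thesis
      proof (rule bin_span_mono)
        fix g assume g: "g \<in> {g \<in> ?N S. Poly_Mapping.keys g \<subseteq> Poly_Mapping.keys f}"
        have "g \<in> ?M S"
          by (rule M_support[of f]) (use f g in \<open>auto simp: mem_ideal_Inter\<close>)
        then have "g \<in> \<pp> i" if "i \<in> {1..k}" for i
          using g V_sub_p[OF that] E_sub_p[OF that] that unfolding mem_ideal_Inter by blast
        then show "g \<in> I"
          using g unfolding I mem_ideal_Inter by blast
      qed
    qed
  qed
  have "returned_ideal X k Y J \<subseteq> Bin X I"
    unfolding returned Bin_I using T_sub by (auto intro!: bin_span_sum)
  moreover have "Bin X I \<subseteq> returned_ideal X k Y J"
    unfolding Bin_I
  proof (rule bin_span_subset)
    have T_zero: "0 \<in> ?T S" if "S \<subseteq> {1..k}" for S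
    proof -
      have "0 \<in> ?M S" unfolding mem_ideal_Inter V_eq by (simp add: carrier_poly_ring)
      moreover have "0 \<in> J_sub X J S"
      proof (cases "S = {}")
        case True
        then show ?thesis using J_empty by (simp add: carrier_poly_ring)
      next
        case False
        then show ?thesis using J_nonempty[OF False that] bin_span.zero by metis
      qed
      ultimately show ?thesis ..
    qed
    have T_add: "f + g \<in> ?T S" if "S \<subseteq> {1..k}" "f \<in> ?T S" "g \<in> ?T S" for f g S
    proof -
      have "ideal (?V i) (poly_ring X)" for i
        by (rule var_ideal_ideal) blast
      then have "ideal (?M S) (poly_ring X)" by (rule poly_ideal_Inter)
      then have "f + g \<in> ?M S" using that unfolding poly_ideal_iff by blast
      moreover have "f + g \<in> J_sub X J S"
      proof (cases "S = {}")
        case True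
        then show ?thesis
          using that J_empty ring.ring_simprules(1)[OF ring_poly_ring, of f X g] by simp
      next
        case False
        then show ?thesis using that J_nonempty[OF False that(1)] bin_span_add by blast
      qed
      ultimately show ?thesis ..
    qed
    show "0 \<in> returned_ideal X k Y J"
      unfolding returned using T_zero by (auto intro!: exI[of _ "\<lambda>_. 0"])
    show "f + g \<in> returned_ideal X k Y J"
      if fg: "f \<in> returned_ideal X k Y J" "g \<in> returned_ideal X k Y J" for f g
    proof -
      obtain h h' where "f = sum h (Pow {1..k})" "\<forall>S\<in>Pow {1..k}. h S \<in> ?T S"
        "g = sum h' (Pow {1..k})" "\<forall>S\<in>Pow {1..k}. h' S \<in> ?T S"
        using fg unfolding returned by blast
      then have "f + g = (\<Sum>S\<in>Pow {1..k}. h S + h' S)" "\<forall>S\<in>Pow {1..k}. h S + h' S \<in> ?T S"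
        using T_add by (simp add: sum.distrib, blast)
      then show ?thesis unfolding returned by blast
    qed
    fix g assume g: "g \<in> I" "is_monomial g \<or> is_binomial g"
    \<comment> \<open>Outside \<open>?S\<close> the element \<open>g\<close> lies in \<open>\<langle>X - Y i\<rangle>\<close>; for \<open>i \<in> ?S\<close> it is thus forced into \<open>K[Y i]\<close>.\<close>
    let ?S = "{i \<in> {1..k}. g \<notin> ?V i}"
    have gp: "g \<in> \<pp> i" if "i \<in> {1..k}" for i
      using g(1) that unfolding I mem_ideal_Inter by blast
    have g_carrier: "g \<in> carrier (poly_ring X)"
      using g(1) unfolding I mem_ideal_Inter by blast
    have "g \<in> ?M ?S"
      using g_carrier unfolding mem_ideal_Inter by blast
    moreover have "g \<in> J_sub X J ?S"
    proof (cases "?S = {}")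
      case True
      show ?thesis unfolding True J_empty by (rule g_carrier)
    next
      case False
      have "g \<in> ?E i" if i: "i \<in> {1..k}" "g \<notin> ?V i" for i
      proof -
        have "g \<in> carrier (poly_ring (Y i))"
          using prime_monomial_or_binomial_cases[OF prime[OF i(1)] gp[OF i(1)] g(2)] i(2)
          unfolding Z[OF i(1), symmetric] Y[OF i(1), symmetric] by blast
        moreover have "J i = bin_span (\<pp> i \<inter> carrier (poly_ring (Y i)))"
          unfolding assms(6)[OF i(1)]
          by (intro Bin_eq_bin_span ideal_restrict[OF p_ideal[OF i(1)]]) (auto simp: Y[OF i(1)])
        ultimately have "g \<in> J i" using gp[OF i(1)] g(2) bin_span_base by blast
        then show ?thesis using J_sub_E[OF i(1)] by blast
      qed
      then have "g \<in> ?N ?S"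
        using g_carrier unfolding mem_ideal_Inter by blast
      moreover have "J_sub X J ?S = bin_span (?N ?S)"
        using False by (rule J_nonempty) blast
      ultimately show ?thesis using g(2) bin_span_base by blast
    qed
    ultimately have gT: "g \<in> ?T ?S" ..
    let ?h = "\<lambda>S. if S = ?S then g else 0"
    have "sum ?h (Pow {1..k}) = g"
      by (subst sum.delta) auto
    moreover have "?h S \<in> ?T S" if "S \<in> Pow {1..k}" for S
      using gT T_zero that by auto
    ultimately show "g \<in> returned_ideal X k Y J"
      unfolding returned mem_Collect_eq by (intro exI[of _ ?h]) simp
  qed
  ultimately show ?thesis using part1 by blast
qed

end
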